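(* For every real $\alpha\in(0,\tfrac12)$ there is $\nu_0=\nu_0(\alpha)>0$ such that for every $0<\nu<\nu_0$, the random graph $G_{\mathrm{Po}}(n;\alpha,\nu)$ has no near perfect matching with probability $1-o(n^{-1/2})$ as $n\to\infty$.
   Context: KPKVB model: fix $\alpha>0$, $\nu>0$, an integer $n>\nu$, and $R=2\ln(n/\nu)$. $\mathcal D_R$ is the hyperbolic disk (curvature $-1$) of radius $R$ around the origin, with polar coordinates $(r,\theta)$, $r\in[0,R)$, $\theta\in(0,2\pi]$; $f_{\alpha,R}(r,\theta)=\frac{\alpha\sinh(\alpha r)}{2\pi(\cosh(\alpha R)-1)}$. Poissonised model $G_{\mathrm{Po}}(n;\alpha,\nu)$: the vertex set is a Poisson point process $\mathcal P$ on $\mathcal D_R$ with intensity measure $n f_{\alpha,R}(r,\theta)\,dr\,d\theta$, two distinct points adjacent iff their hyperbolic distance is at most $R$. A near perfect matching is a matching covering all but at most one vertex. *)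

theory Defs
  imports "HOL-Probability.Probability" "HOL-Library.Landau_Symbols"
begin

definition kpkvb_R :: "real \<Rightarrow> nat \<Rightarrow> real" where
  "kpkvb_R \<nu> n = 2 * ln (real n / \<nu>)"

definition hdisk :: "real \<Rightarrow> (real \<times> real) set" where
  "hdisk R = {(r, \<theta>). 0 \<le> r \<and> r < R \<and> 0 < \<theta> \<and> \<theta> \<le> 2 * pi}"

text \<open>Hyperbolic distance (curvature -1) between points in polar coordinates
  (hyperbolic law of cosines).\<close>
definition hdist :: "real \<times> real \<Rightarrow> real \<times> real \<Rightarrow> real" where
  "hdist p q = (case p of (r1, \<theta>1) \<Rightarrow> case q of (r2, \<theta>2) \<Rightarrow>
     arcosh (cosh r1 * cosh r2 - sinh r1 * sinh r2 * cos (\<theta>1 - \<theta>2)))"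

definition f_dens :: "real \<Rightarrow> real \<Rightarrow> real \<times> real \<Rightarrow> real" where
  "f_dens \<alpha> R p = (case p of (r, \<theta>) \<Rightarrow>
     \<alpha> * sinh (\<alpha> * r) / (2 * pi * (cosh (\<alpha> * R) - 1)))"

definition hpt_measure :: "real \<Rightarrow> real \<Rightarrow> (real \<times> real) measure" where
  "hpt_measure \<alpha> R =
     density lborel (\<lambda>p. ennreal (indicator (hdisk R) p * f_dens \<alpha> R p))"

definition is_matching :: "('a \<Rightarrow> 'a \<Rightarrow> bool) \<Rightarrow> 'a set set \<Rightarrow> bool" where
  "is_matching E M \<longleftrightarrow>
     (\<forall>e\<in>M. \<exists>u v. e = {u, v} \<and> u \<noteq> v \<and> E u v) \<and>
     (\<forall>e\<in>M. \<forall>e'\<in>M. e \<noteq> e' \<longrightarrow> e \<inter> e' = {})"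

definition has_near_perfect_matching :: "'a set \<Rightarrow> ('a \<Rightarrow> 'a \<Rightarrow> bool) \<Rightarrow> bool" where
  "has_near_perfect_matching V E \<longleftrightarrow>
     (\<exists>M. (\<forall>e\<in>M. e \<subseteq> V) \<and> is_matching E M \<and> card (V - \<Union>M) \<le> 1)"

definition hgraph_adj :: "real \<Rightarrow> (nat \<Rightarrow> real \<times> real) \<Rightarrow> nat \<Rightarrow> nat \<Rightarrow> bool" where
  "hgraph_adj R x i j \<longleftrightarrow> i \<noteq> j \<and> hdist (x i) (x j) \<le> R"

definition npm_event :: "real \<Rightarrow> real \<Rightarrow> nat \<Rightarrow> (nat \<Rightarrow> real \<times> real) set" where
  "npm_event \<alpha> R k =
     {x \<in> space (PiM {..<k} (\<lambda>_. hpt_measure \<alpha> R)).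
        has_near_perfect_matching {..<k} (hgraph_adj R x)}"

text \<open>The Poisson point process with finite intensity measure n f dr dtheta
  (total mass n) is: N ~ Poisson(n) many points, then N i.i.d. points with
  density f. Probability that G_Po(n; alpha, nu) has a near perfect matching:\<close>
definition prob_npm :: "real \<Rightarrow> real \<Rightarrow> nat \<Rightarrow> real" where
  "prob_npm \<alpha> \<nu> n =
     (let R = kpkvb_R \<nu> n in
      \<Sum>k. exp (- real n) * real n ^ k / fact k *
           measure (PiM {..<k} (\<lambda>_. hpt_measure \<alpha> R)) (npm_event \<alpha> R k))"

end

theory Submission
  imports Defs "HOL-Real_Asymp.Real_Asymp"
begin

text \<open>Call the points at distance less than \<open>C\<close> from the boundary of the disk outer points.
  Fix \<open>C\<close> so large that all but a twelfth of the mass is outer; two outer points are then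
  adjacent with probability only \<open>O(\<nu> / n)\<close>, so for small \<open>\<nu>\<close> most outer points have only
  inner neighbours, and there are too few inner points to match them.

  Add the points one at a time and call a point bad if it is inner or adjacent to an earlier outer
  point. Every edge contains a bad vertex, so a near perfect matching forces
  \<open>k \<le> 2 * B + 1\<close>, where \<open>B\<close> is the number of bad points among \<open>k\<close>. Given the earlier points each
  point is bad with probability at most \<open>1/6\<close> when \<open>k \<le> 2 * n\<close>, so \<open>4 ^ B\<close> has mean at most
  \<open>(3/2) ^ k\<close>, and Markov's inequality bounds the matching probability by \<open>2 * (3/4) ^ k\<close>.
  Averaging over the Poisson number of points gives a bound exponentially small in \<open>n\<close>.\<close>

section \<open>Counting: matchings and bad vertices\<close>

text \<open>\<open>G\<close> will be the set of outer points. Looking back only at indices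
  \<open>j < i\<close> makes the badness of \<open>i\<close> a function of the first
  \<open>i + 1\<close> points, so that the points can be exposed one at a time.\<close>

definition bad_vertex :: "'a set \<Rightarrow> ('a \<Rightarrow> 'a \<Rightarrow> bool) \<Rightarrow> (nat \<Rightarrow> 'a) \<Rightarrow> nat \<Rightarrow> bool" where
  "bad_vertex G E x i \<longleftrightarrow> x i \<notin> G \<or> (\<exists>j<i. x j \<in> G \<and> E (x j) (x i))"

text \<open>Choosing an element of \<open>B\<close> in each edge is injective because the edges are
  disjoint. So there are at most \<open>card B\<close> edges, each with at most two
  endpoints.\<close>

lemma matching_card_le_hitting_set:
  assumes "is_matching E M" "finite B" "\<And>e. e \<in> M \<Longrightarrow> e \<inter> B \<noteq> {}"
  shows "card (\<Union>M) \<le> 2 * card B"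
proof -
  define g where "g e = (SOME b. b \<in> e \<inter> B)" for e
  have g: "g e \<in> e \<inter> B" if "e \<in> M" for e
    unfolding g_def using assms(3)[OF that] by (metis ex_in_conv someI_ex)
  have inj: "inj_on g M"
  proof (rule inj_onI)
    fix e e' assume h: "e \<in> M" "e' \<in> M" "g e = g e'"
    then have "g e \<in> e \<inter> e'" using g by fastforce
    then show "e = e'"
      using bspec[OF bspec[OF conjunct2[OF assms(1)[unfolded is_matching_def]] h(1)] h(2)] by blast
  qed
  have sub: "g ` M \<subseteq> B" using g by blast
  have "card (\<Union>M) \<le> (\<Sum>e\<in>M. card e)" by (rule card_Union_le_sum_card)
  also have "\<dots> \<le> (\<Sum>e\<in>M. 2)"
  proof (rule sum_mono)
    fix e assume "e \<in> M"
    then obtain u v where "e = {u, v}"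
      using bspec[OF conjunct1[OF assms(1)[unfolded is_matching_def]]] by blast
    then show "card e \<le> 2" by (simp add: card_insert_if)
  qed
  also have "\<dots> = 2 * card M" by simp
  also have "\<dots> \<le> 2 * card B" using inj sub assms(2) card_inj_on_le by fastforce
  finally show "card (\<Union>M) \<le> 2 * card B" .
qed

text \<open>The bad vertices meet every edge: if the earlier endpoint lies in \<open>G\<close>, the
  later one is bad through it, and otherwise the earlier one is bad itself. The \<open>+ 1\<close>
  pays for the one vertex that may stay unmatched.\<close>

lemma near_perfect_matching_bad_vertices:
  fixes E :: "'a \<Rightarrow> 'a \<Rightarrow> bool"
  assumes npm: "has_near_perfect_matching {..<k} (\<lambda>i j. i \<noteq> j \<and> E (x i) (x j))"
    and sym: "\<And>a b. E a b = E b a"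
  shows "k \<le> 2 * card {i. i < k \<and> bad_vertex G E x i} + 1"
proof -
  let ?B = "{i. i < k \<and> bad_vertex G E x i}"
  obtain M where M: "\<forall>e\<in>M. e \<subseteq> {..<k}" "is_matching (\<lambda>i j. i \<noteq> j \<and> E (x i) (x j)) M"
    "card ({..<k} - \<Union>M) \<le> 1"
    using npm unfolding has_near_perfect_matching_def by (elim exE conjE) (rule that)
  have "e \<inter> ?B \<noteq> {}" if e: "e \<in> M" for e
  proof -
    obtain u v where uv: "e = {u, v}" "u \<noteq> v" "E (x u) (x v)"
      using bspec[OF conjunct1[OF M(2)[unfolded is_matching_def]] e] by auto
    have lt: "u < k" "v < k" using M(1) e uv by auto
    have "bad_vertex G E x u \<or> bad_vertex G E x v"
    proof (cases "u < v")
      case True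
      then show ?thesis using uv(3) unfolding bad_vertex_def by blast
    next
      case False
      then have "v < u" using uv(2) by simp
      moreover have "E (x v) (x u)" using uv(3) sym[of "x u" "x v"] by simp
      ultimately show ?thesis unfolding bad_vertex_def by blast
    qed
    then show ?thesis using uv lt by auto
  qed
  then have "card (\<Union>M) \<le> 2 * card ?B"
    using matching_card_le_hitting_set[OF M(2), of ?B] by simp
  moreover have "k \<le> card ({..<k} - \<Union>M) + card (\<Union>M)"
  proof -
    have "finite (\<Union>M)" using M(1) by (intro finite_subset[of "\<Union>M" "{..<k}"]) auto
    then show ?thesis using diff_card_le_card_Diff[of "\<Union>M" "{..<k}"] by simp
  qed
  ultimately show ?thesis using M(3) by linarith
qed

section \<open>Exponential moments and Markov's inequality over a general probability space\<close>

lemma bad_vertex_measurable: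
  assumes G: "G \<in> sets M"
    and E: "Measurable.pred (M \<Otimes>\<^sub>M M) (\<lambda>(x, y). E x y)"
    and i: "i \<in> I" "{..i} \<subseteq> I"
  shows "Measurable.pred (PiM I (\<lambda>_. M)) (\<lambda>x. bad_vertex G E x i)"
proof -
  have "Measurable.pred (PiM I (\<lambda>_. M)) (\<lambda>x. E (x j) (x i))" if "j \<in> {..<i}" for j
  proof -
    have "(\<lambda>x. (x j, x i)) \<in> PiM I (\<lambda>_. M) \<rightarrow>\<^sub>M M \<Otimes>\<^sub>M M"
      using i that by (intro measurable_Pair measurable_component_singleton) auto
    from measurable_compose[OF this E] show ?thesis by simp
  qed
  moreover have "Measurable.pred (PiM I (\<lambda>_. M)) (\<lambda>x. x j \<in> G)" if "j \<in> {..i}" for j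
    using G i that by (intro pred_sets2[OF G] measurable_component_singleton) auto
  ultimately have "Measurable.pred (PiM I (\<lambda>_. M))
      (\<lambda>x. x i \<notin> G \<or> (\<exists>j\<in>{..<i}. x j \<in> G \<and> E (x j) (x i)))"
    by (intro pred_intros_logic pred_intros_finite) auto
  then show ?thesis unfolding bad_vertex_def by (simp add: Bex_def)
qed

lemma bad_vertex_weight_measurable:
  assumes G: "G \<in> sets M"
    and E: "Measurable.pred (M \<Otimes>\<^sub>M M) (\<lambda>(x, y). E x y)"
  shows "(\<lambda>x. \<Prod>i<m. if bad_vertex G E x i then 4 else (1::ennreal))
    \<in> borel_measurable (PiM {..<m} (\<lambda>_. M))"
proof (intro borel_measurable_prod_ennreal measurable_If borel_measurable_const)
  fix i assume "i \<in> {..<m}"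
  then have "Measurable.pred (PiM {..<m} (\<lambda>_. M)) (\<lambda>x. bad_vertex G E x i)"
    by (intro bad_vertex_measurable[OF G E]) auto
  then show "{x \<in> space (PiM {..<m} (\<lambda>_. M)). bad_vertex G E x i} \<in> sets (PiM {..<m} (\<lambda>_. M))"
    by (simp only: pred_def)
qed

text \<open>Redrawing the point with index \<open>k\<close> leaves the verdict on all earlier points
  unchanged, so their factors come out of the integral over the new point.\<close>

lemma bad_vertex_fun_upd:
  "i < k \<Longrightarrow> bad_vertex G E (x(k := y)) i = bad_vertex G E x i"
proof -
  assume "i < k"
  then have "(x(k := y)) j = x j" if "j \<le> i" for j using that by simp
  then show ?thesis unfolding bad_vertex_def by (simp del: fun_upd_apply cong: conj_cong)
qed

text \<open>Conditionally on the earlier points each point is bad with probability at most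
  \<open>\<rho>\<close>, so the factors contribute at most \<open>1 + 3 * \<rho>\<close> each.\<close>
lemma bad_vertex_exponential_moment:
  assumes "prob_space M" and G: "G \<in> sets M"
    and E: "Measurable.pred (M \<Otimes>\<^sub>M M) (\<lambda>(x, y). E x y)"
    and q: "measure M (space M - G) \<le> q"
    and p: "\<And>x. x \<in> G \<Longrightarrow> measure M {y \<in> space M. y \<in> G \<and> E x y} \<le> p"
    and p0: "0 \<le> p"
    and \<rho>: "q + real k * p \<le> \<rho>"
  shows "(\<integral>\<^sup>+x. (\<Prod>i<k. if bad_vertex G E x i then 4 else 1) \<partial>PiM {..<k} (\<lambda>_. M))
    \<le> ennreal (1 + 3 * \<rho>) ^ k"
  \<comment> \<open>The bound on \<open>\<rho>\<close> mentions \<open>k\<close>, so it enters the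
    induction statement; it passes from \<open>Suc k\<close> to \<open>k\<close> because
    \<open>p\<close> is nonnegative.\<close>
  using \<rho>
proof (induction k)
  case 0
  show ?case by (simp add: PiM_empty nn_integral_count_space_finite)
next
  case (Suc k)
  interpret prob_space M by fact
  interpret P: product_prob_space "\<lambda>_. M" by unfold_locales
  have q0: "0 \<le> q" using q measure_nonneg order_trans by blast
  have \<rho>k: "q + real k * p \<le> \<rho>" using Suc.prems p0 by (simp add: algebra_simps)
  have \<rho>0: "0 \<le> \<rho>" using \<rho>k q0 p0 by (smt (verit) mult_nonneg_nonneg of_nat_0_le_iff)
  let ?w = "\<lambda>x i. if bad_vertex G E x i then 4 else (1::ennreal)"
  have wm: "(\<lambda>x. \<Prod>i<m. ?w x i) \<in> borel_measurable (PiM {..<m} (\<lambda>_. M))" for m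
    by (rule bad_vertex_weight_measurable[OF G E])
  have ins: "insert k {..<k} = {..<Suc k}" by auto
  \<comment> \<open>With the earlier points fixed, the new point is bad exactly when it falls in
    \<open>T\<close>, the complement of \<open>G\<close> together with the neighbourhoods of at most
    \<open>k\<close> earlier points of \<open>G\<close>. The union bound gives \<open>T\<close>
    measure at most \<open>\<rho>\<close>.\<close>
  have inner: "(\<integral>\<^sup>+y. ?w (x(k := y)) k \<partial>M) \<le> ennreal (1 + 3 * \<rho>)"
    if x: "x \<in> space (PiM {..<k} (\<lambda>_. M))" for x
  proof -
    define S where "S j = {y \<in> space M. y \<in> G \<and> E (x j) y}" for j
    have Sm: "S j \<in> sets M" if "j < k" for j
    proof -
      have "x j \<in> space M" using x that by (auto simp: space_PiM PiE_iff)
      then have "(\<lambda>y. (x j, y)) \<in> M \<rightarrow>\<^sub>M M \<Otimes>\<^sub>M M" by simp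
      from measurable_compose[OF this E] have "Measurable.pred M (\<lambda>y. E (x j) y)" by simp
      then have "{y \<in> space M. E (x j) y} \<in> sets M" by (simp add: pred_def)
      then have "G \<inter> {y \<in> space M. E (x j) y} \<in> sets M" using G by blast
      moreover have "G \<inter> {y \<in> space M. E (x j) y} = S j"
        using sets.sets_into_space[OF G] by (auto simp: S_def)
      ultimately show ?thesis by simp
    qed
    define J where "J = {j. j < k \<and> x j \<in> G}"
    define T where "T = (space M - G) \<union> (\<Union>j\<in>J. S j)"
    have Jf: "finite J" by (simp add: J_def)
    have Tm: "T \<in> sets M" unfolding T_def using G Sm Jf
      by (intro sets.Un sets.finite_UN) (auto simp: J_def)
    have "measure M T \<le> measure M (space M - G) + measure M (\<Union>j\<in>J. S j)"
      unfolding T_def using G Sm Jf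
      by (intro measure_Un_le sets.finite_UN) (auto simp: J_def)
    also have "measure M (\<Union>j\<in>J. S j) \<le> (\<Sum>j\<in>J. measure M (S j))"
      using Sm Jf by (intro finite_measure_subadditive_finite) (auto simp: J_def)
    also have "\<dots> \<le> (\<Sum>j\<in>J. p)"
      by (intro sum_mono) (auto simp: S_def J_def intro: p)
    also have "\<dots> = real (card J) * p" by simp
    also have "\<dots> \<le> real k * p"
    proof -
      have "card J \<le> card {..<k}" by (rule card_mono) (auto simp: J_def)
      then show ?thesis using p0 by (intro mult_right_mono) auto
    qed
    finally have mT: "measure M T \<le> \<rho>" using q \<rho>k by linarith
    have "(\<integral>\<^sup>+y. ?w (x(k := y)) k \<partial>M) = (\<integral>\<^sup>+y. 1 + 3 * indicator T y \<partial>M)"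
    proof (rule nn_integral_cong)
      fix y assume y: "y \<in> space M"
      have "bad_vertex G E (x(k := y)) k \<longleftrightarrow> y \<in> T"
        using y unfolding bad_vertex_def T_def S_def J_def by auto
      then show "?w (x(k := y)) k = 1 + 3 * indicator T y" by simp
    qed
    also have "\<dots> = 1 + 3 * emeasure M T"
      using Tm by (simp add: nn_integral_add nn_integral_cmult emeasure_space_1)
    also have "\<dots> = ennreal (1 + 3 * measure M T)"
      by (simp add: emeasure_eq_measure ennreal_mult ennreal_plus)
    also have "\<dots> \<le> ennreal (1 + 3 * \<rho>)"
      using mT by (intro ennreal_leI) simp
    finally show ?thesis .
  qed
  have "(\<integral>\<^sup>+x. (\<Prod>i<Suc k. ?w x i) \<partial>PiM {..<Suc k} (\<lambda>_. M))
    = (\<integral>\<^sup>+x. (\<integral>\<^sup>+y. (\<Prod>i<Suc k. ?w (x(k := y)) i) \<partial>M) \<partial>PiM {..<k} (\<lambda>_. M))"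
    using P.product_nn_integral_insert[of "{..<k}" k "\<lambda>x. \<Prod>i<Suc k. ?w x i"] wm[of "Suc k"]
    unfolding ins by simp
  also have "\<dots> = (\<integral>\<^sup>+x. (\<integral>\<^sup>+y. (\<Prod>i<k. ?w x i) * ?w (x(k := y)) k \<partial>M) \<partial>PiM {..<k} (\<lambda>_. M))"
    by (simp add: bad_vertex_fun_upd del: fun_upd_apply cong: if_cong)
  also have "\<dots> \<le> (\<integral>\<^sup>+x. (\<Prod>i<k. ?w x i) * ennreal (1 + 3 * \<rho>) \<partial>PiM {..<k} (\<lambda>_. M))"
  proof (rule nn_integral_mono)
    fix x assume x: "x \<in> space (PiM {..<k} (\<lambda>_. M))"
    have up: "(\<lambda>y. x(k := y)) \<in> M \<rightarrow>\<^sub>M PiM {..<Suc k} (\<lambda>_. M)"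
      using measurable_compose[OF _ measurable_add_dim, of "\<lambda>y. (x, y)" M "{..<k}" "\<lambda>_. M" k] x
      unfolding ins by simp
    have "Measurable.pred (PiM {..<Suc k} (\<lambda>_. M)) (\<lambda>x. bad_vertex G E x k)"
      by (rule bad_vertex_measurable[OF G E]) auto
    from measurable_compose[OF up this]
    have "Measurable.pred M (\<lambda>y. bad_vertex G E (x(k := y)) k)" .
    then have "(\<lambda>y. ?w (x(k := y)) k) \<in> borel_measurable M"
      by (intro measurable_If borel_measurable_const) (auto simp: pred_def)
    then have "(\<integral>\<^sup>+y. (\<Prod>i<k. ?w x i) * ?w (x(k := y)) k \<partial>M)
        = (\<Prod>i<k. ?w x i) * (\<integral>\<^sup>+y. ?w (x(k := y)) k \<partial>M)"
      by (rule nn_integral_cmult)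
    also have "\<dots> \<le> (\<Prod>i<k. ?w x i) * ennreal (1 + 3 * \<rho>)"
      by (intro mult_left_mono inner x) simp
    finally show "(\<integral>\<^sup>+y. (\<Prod>i<k. ?w x i) * ?w (x(k := y)) k \<partial>M)
      \<le> (\<Prod>i<k. ?w x i) * ennreal (1 + 3 * \<rho>)" .
  qed
  also have "\<dots> = (\<integral>\<^sup>+x. (\<Prod>i<k. ?w x i) \<partial>PiM {..<k} (\<lambda>_. M)) * ennreal (1 + 3 * \<rho>)"
    by (rule nn_integral_multc[OF wm])
  also have "\<dots> \<le> ennreal (1 + 3 * \<rho>) ^ k * ennreal (1 + 3 * \<rho>)"
    by (intro mult_right_mono Suc.IH \<rho>k) simp
  finally show ?case by (simp add: mult.commute)
qed

text \<open>Markov's inequality for the weight \<open>w\<close>, which is 4 to the number of bad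
  vertices: a near perfect matching forces \<open>2 ^ k \<le> 2 * w\<close>, while the mean of
  \<open>w\<close> is at most \<open>(1 + 3 / 6) ^ k = (3/2) ^ k\<close>.\<close>

lemma prob_near_perfect_matching_le:
  assumes "prob_space M" and G: "G \<in> sets M"
    and E: "Measurable.pred (M \<Otimes>\<^sub>M M) (\<lambda>(x, y). E x y)"
    and sym: "\<And>a b. E a b = E b a"
    and q: "measure M (space M - G) \<le> q"
    and p: "\<And>x. x \<in> G \<Longrightarrow> measure M {y \<in> space M. y \<in> G \<and> E x y} \<le> p"
    and p0: "0 \<le> p"
    and \<rho>: "q + real k * p \<le> 1 / 6"
  shows "measure (PiM {..<k} (\<lambda>_. M)) {x \<in> space (PiM {..<k} (\<lambda>_. M)).
      has_near_perfect_matching {..<k} (\<lambda>i j. i \<noteq> j \<and> E (x i) (x j))} \<le> 2 * (3/4) ^ k"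
    (is "measure ?P ?A \<le> _")
proof -
  interpret P: prob_space ?P by (rule prob_space_PiM) (rule assms(1))
  define w where "w = (\<lambda>x. \<Prod>i<k. if bad_vertex G E x i then 4 else (1::ennreal))"
  have wm: "w \<in> borel_measurable ?P"
    unfolding w_def by (rule bad_vertex_weight_measurable[OF G E])
  have "w x = 4 ^ card {i. i < k \<and> bad_vertex G E x i}" for x
  proof -
    have "w x = (\<Prod>i\<in>{..<k} \<inter> {i. bad_vertex G E x i}. 4)"
      unfolding w_def by (subst prod.If_cases) simp_all
    also have "{..<k} \<inter> {i. bad_vertex G E x i} = {i. i < k \<and> bad_vertex G E x i}" by auto
    finally show ?thesis by simp
  qed
  then have w: "2 ^ k \<le> 2 * w x" if "x \<in> ?A" for x
  proof -
    let ?c = "card {i. i < k \<and> bad_vertex G E x i}"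
    have "k \<le> 2 * ?c + 1"
      using near_perfect_matching_bad_vertices[of k E x G] that sym by blast
    then have "(2::ennreal) ^ k \<le> 2 ^ (2 * ?c + 1)" by (intro power_increasing) auto
    \<comment> \<open>The weight 4 per bad vertex is the square of 2, matching the factor 2 in
      \<open>k \<le> 2 * ?c + 1\<close>.\<close>
    also have "\<dots> = 2 * 4 ^ ?c" by (simp add: power_mult power_add mult.commute)
    finally show ?thesis using \<open>w x = 4 ^ ?c\<close> by simp
  qed
  have wI: "(\<integral>\<^sup>+x. w x \<partial>?P) \<le> ennreal (3 / 2) ^ k"
    using bad_vertex_exponential_moment[OF assms(1) G E q p p0 \<rho>] unfolding w_def by simp
  \<comment> \<open>\<open>c\<close> is the inverse of \<open>2 ^ k\<close>, so that the threshold
    for \<open>w\<close> becomes \<open>1 \<le> 2 * c * w\<close>, the form that Markov's inequality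
    takes for \<open>ennreal\<close>.\<close>
  define c where "c = ennreal ((1/2) ^ k)"
  have c2: "c * 2 ^ k = 1"
  proof -
    have "(2::ennreal) ^ k = ennreal (2 ^ k)" by (metis ennreal_numeral ennreal_power zero_le_numeral)
    then have "c * 2 ^ k = ennreal ((1/2) ^ k * 2 ^ k)"
      unfolding c_def by (subst ennreal_mult) simp_all
    then show ?thesis by (simp add: power_one_over)
  qed
  \<comment> \<open>The estimate is made for the measurable superset \<open>?B\<close> and passes to
    \<open>?A\<close> by monotonicity.\<close>
  let ?B = "{x \<in> space ?P. 1 \<le> 2 * c * w x}"
  have AB: "?A \<subseteq> ?B"
  proof
    fix x assume x: "x \<in> ?A"
    have "c * 2 ^ k \<le> c * (2 * w x)" by (intro mult_left_mono w x) simp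
    then show "x \<in> ?B" using x unfolding c2 by (simp add: mult_ac)
  qed
  have Bm: "?B \<in> sets ?P" using wm by measurable
  have "emeasure ?P ?B \<le> 2 * c * (\<integral>\<^sup>+x. w x * indicator (space ?P) x \<partial>?P)"
    by (rule nn_integral_Markov_inequality) (use wm in measurable)
  also have "(\<integral>\<^sup>+x. w x * indicator (space ?P) x \<partial>?P) = (\<integral>\<^sup>+x. w x \<partial>?P)"
    by (intro nn_integral_cong) simp
  also have "2 * c * (\<integral>\<^sup>+x. w x \<partial>?P) \<le> 2 * c * ennreal (3 / 2) ^ k"
    by (intro mult_left_mono wI) simp
  also have "\<dots> = 2 * (c * ennreal ((3 / 2) ^ k))"
    by (subst ennreal_power) (simp_all add: mult.assoc)
  also have "c * ennreal ((3 / 2) ^ k) = ennreal ((3/4) ^ k)"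
    unfolding c_def by (subst ennreal_mult[symmetric]) (simp_all flip: power_mult_distrib)
  also have "2 * ennreal ((3/4) ^ k) = ennreal (2 * (3/4) ^ k)"
    by (subst ennreal_mult) simp_all
  finally have "measure ?P ?B \<le> 2 * (3/4) ^ k" by (simp add: P.emeasure_eq_measure)
  with P.finite_measure_mono[OF AB Bm] show ?thesis by linarith
qed

text \<open>A matching inside \<open>{..<k}\<close> is one of finitely many sets of sets, so the
  event is a finite Boolean combination of measurable adjacency events.\<close>

lemma near_perfect_matching_sets:
  fixes k :: nat
  assumes E: "Measurable.pred (M \<Otimes>\<^sub>M M) (\<lambda>(x, y). E x y)"
  shows "{x \<in> space (PiM {..<k} (\<lambda>_. M)).
      has_near_perfect_matching {..<k} (\<lambda>i j. i \<noteq> j \<and> E (x i) (x j))} \<in> sets (PiM {..<k} (\<lambda>_. M))"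
proof -
  let ?P = "PiM {..<k} (\<lambda>_. M)"
  have edge: "Measurable.pred ?P (\<lambda>x. E (x u) (x v))" if "u \<in> {..<k}" "v \<in> {..<k}" for u v
  proof -
    have "(\<lambda>x. (x u, x v)) \<in> ?P \<rightarrow>\<^sub>M M \<Otimes>\<^sub>M M"
      using that by (intro measurable_Pair measurable_component_singleton) auto
    from measurable_compose[OF this E] show ?thesis by simp
  qed
  have eq: "has_near_perfect_matching {..<k} (\<lambda>i j. i \<noteq> j \<and> E (x i) (x j)) \<longleftrightarrow>
     (\<exists>N\<in>Pow (Pow {..<k}). (\<forall>e\<in>N. \<exists>u\<in>{..<k}. \<exists>v\<in>{..<k}. (e = {u, v} \<and> u \<noteq> v) \<and> E (x u) (x v))
        \<and> ((\<forall>e\<in>N. \<forall>e'\<in>N. e \<noteq> e' \<longrightarrow> e \<inter> e' = {}) \<and> card ({..<k} - \<Union>N) \<le> 1))" (is "?L \<longleftrightarrow> ?R") for x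
  proof
    assume ?L
    then obtain N where N: "\<forall>e\<in>N. e \<subseteq> {..<k}"
      "\<forall>e\<in>N. \<exists>u v. e = {u, v} \<and> u \<noteq> v \<and> u \<noteq> v \<and> E (x u) (x v)"
      "\<forall>e\<in>N. \<forall>e'\<in>N. e \<noteq> e' \<longrightarrow> e \<inter> e' = {}" "card ({..<k} - \<Union>N) \<le> 1"
      unfolding has_near_perfect_matching_def is_matching_def by (elim exE conjE) (rule that)
    have "\<exists>u\<in>{..<k}. \<exists>v\<in>{..<k}. (e = {u, v} \<and> u \<noteq> v) \<and> E (x u) (x v)" if e: "e \<in> N" for e
    proof -
      obtain u v where "e = {u, v}" "u \<noteq> v" "E (x u) (x v)" using bspec[OF N(2) e] by auto
      with bspec[OF N(1) e] show ?thesis by auto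
    qed
    with N(1,3,4) show ?R by (intro bexI[of _ N] conjI) auto
  next
    assume ?R
    then obtain N where N: "N \<in> Pow (Pow {..<k})"
      "\<forall>e\<in>N. \<exists>u\<in>{..<k}. \<exists>v\<in>{..<k}. (e = {u, v} \<and> u \<noteq> v) \<and> E (x u) (x v)"
      "\<forall>e\<in>N. \<forall>e'\<in>N. e \<noteq> e' \<longrightarrow> e \<inter> e' = {}" "card ({..<k} - \<Union>N) \<le> 1"
      by (elim bexE conjE) (rule that)
    have "\<exists>u v. e = {u, v} \<and> u \<noteq> v \<and> u \<noteq> v \<and> E (x u) (x v)" if e: "e \<in> N" for e
      using bspec[OF N(2) e] by (elim bexE conjE) (intro exI conjI)
    with N(1,3,4) show ?L
      unfolding has_near_perfect_matching_def is_matching_def by (intro exI[of _ N] conjI) auto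
  qed
  have "Measurable.pred ?P (\<lambda>x. has_near_perfect_matching {..<k} (\<lambda>i j. i \<noteq> j \<and> E (x i) (x j)))"
    unfolding eq
    by (intro pred_intros_finite pred_intros_logic edge) (auto intro: finite_subset[of _ "Pow {..<k}"])
  then show ?thesis by (simp only: pred_def)
qed

section \<open>The radial and angular measure on the hyperbolic disk\<close>

lemma sets_hpt_measure [simp, measurable_cong]: "sets (hpt_measure \<alpha> R) = sets borel"
  by (simp add: hpt_measure_def)

lemma space_hpt_measure [simp]: "space (hpt_measure \<alpha> R) = UNIV"
  by (simp add: hpt_measure_def)

lemma borel_measurable_hpt_density:
  "(\<lambda>p. ennreal (indicator (hdisk R) p * f_dens \<alpha> R p)) \<in> borel_measurable borel"
proof -
  have "(\<lambda>p. sinh (\<alpha> * fst p)) \<in> borel_measurable (borel :: (real \<times> real) measure)"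
    by (intro borel_measurable_continuous_onI continuous_intros)
  then have "(\<lambda>p :: real \<times> real. \<alpha> * sinh (\<alpha> * fst p) / (2 * pi * (cosh (\<alpha> * R) - 1))) \<in> borel_measurable borel"
    by measurable
  moreover have "f_dens \<alpha> R = (\<lambda>p. \<alpha> * sinh (\<alpha> * fst p) / (2 * pi * (cosh (\<alpha> * R) - 1)))"
    by (simp add: fun_eq_iff f_dens_def split_beta)
  ultimately have "f_dens \<alpha> R \<in> borel_measurable borel" by simp
  moreover have "hdisk R = {0..<R} \<times> {0<..2 * pi}"
    by (auto simp: hdisk_def)
  then have "hdisk R \<in> sets borel" by (simp add: borel_Times)
  ultimately show ?thesis by measurable
qed

text \<open>The density does not depend on the angle, so Tonelli splits the integral, and the radial
  density has antiderivative \<open>cosh (\<alpha> * r)\<close> up to the normalising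
  constant.\<close>

lemma emeasure_hpt_sector:
  assumes \<alpha>: "0 < \<alpha>" and ab: "0 \<le> a" "a \<le> b" "b \<le> R" "0 < R"
    and J: "J \<in> sets borel" "J \<subseteq> {0<..2 * pi}"
  shows "emeasure (hpt_measure \<alpha> R) ({a..<b} \<times> J) =
    ennreal ((cosh (\<alpha> * b) - cosh (\<alpha> * a)) / (2 * pi * (cosh (\<alpha> * R) - 1))) * emeasure lborel J"
proof -
  define D where "D = 2 * pi * (cosh (\<alpha> * R) - 1)"
  have D: "0 \<le> D" unfolding D_def using cosh_real_ge_1 by (intro mult_nonneg_nonneg) auto
  let ?h = "\<lambda>r. \<alpha> * sinh (\<alpha> * r) / D"
  have "(\<lambda>r. sinh (\<alpha> * r)) \<in> borel_measurable borel"
    by (intro borel_measurable_continuous_onI continuous_intros)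
  then have hm: "?h \<in> borel_measurable borel" by measurable
  let ?g = "\<lambda>r. ennreal (?h r) * indicator {a..<b} r"
  have gm: "?g \<in> borel_measurable borel" using hm by measurable
  have "emeasure (hpt_measure \<alpha> R) ({a..<b} \<times> J) =
    (\<integral>\<^sup>+p. ennreal (indicator (hdisk R) p * f_dens \<alpha> R p) * indicator ({a..<b} \<times> J) p \<partial>lborel)"
    unfolding hpt_measure_def using borel_measurable_hpt_density J
    by (intro emeasure_density) (auto intro: borel_Times)
  also have "\<dots> = (\<integral>\<^sup>+p. ?g (fst p) * indicator J (snd p) \<partial>(lborel \<Otimes>\<^sub>M lborel))"
    unfolding lborel_prod
  proof (rule nn_integral_cong)
    fix p :: "real \<times> real"
    show "ennreal (indicator (hdisk R) p * f_dens \<alpha> R p) * indicator ({a..<b} \<times> J) p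
      = ?g (fst p) * indicator J (snd p)"
      using ab J(2) by (auto simp: indicator_def hdisk_def f_dens_def D_def split: prod.splits)
  qed
  also have "\<dots> = (\<integral>\<^sup>+r. (\<integral>\<^sup>+t. ?g r * indicator J t \<partial>lborel) \<partial>lborel)"
    using gm J(1) by (subst lborel.nn_integral_fst[symmetric]) (simp_all, measurable)
  also have "\<dots> = (\<integral>\<^sup>+r. ?g r * emeasure lborel J \<partial>lborel)"
    using J(1) by (intro nn_integral_cong) (simp add: nn_integral_cmult)
  also have "\<dots> = (\<integral>\<^sup>+r. ?g r \<partial>lborel) * emeasure lborel J"
    using gm by (intro nn_integral_multc) simp
  \<comment> \<open>The fundamental theorem is applied on a closed interval; the added endpoint
    \<open>b\<close> is a null set.\<close>
  also have "(\<integral>\<^sup>+r. ?g r \<partial>lborel) = (\<integral>\<^sup>+r. ennreal (?h r) * indicator {a..b} r \<partial>lborel)"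
    by (intro nn_integral_cong_AE, rule AE_mp[OF AE_lborel_singleton[of b]])
      (auto simp: indicator_def)
  also have "\<dots> = ennreal (cosh (\<alpha> * b) / D - cosh (\<alpha> * a) / D)"
  proof (rule nn_integral_FTC_Icc[OF hm])
    fix r assume r: "r \<in> {a..b}"
    show "((\<lambda>r. cosh (\<alpha> * r) / D) has_real_derivative ?h r) (at r)"
      unfolding divide_inverse by (auto intro!: derivative_eq_intros)
    show "0 \<le> ?h r" using \<alpha> ab r D by (intro divide_nonneg_nonneg mult_nonneg_nonneg) auto
  qed (use ab in auto)
  finally show ?thesis by (simp add: D_def diff_divide_distrib)
qed

lemma prob_space_hpt_measure:
  assumes "0 < \<alpha>" "0 < R"
  shows "prob_space (hpt_measure \<alpha> R)"
proof
  let ?M = "hpt_measure \<alpha> R"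
  have H: "hdisk R = {0..<R} \<times> {0<..2 * pi}" by (auto simp: hdisk_def)
  have Hm: "hdisk R \<in> sets borel" unfolding H by (simp add: borel_Times)
  have c: "cosh (\<alpha> * R) \<noteq> 1" using assms by simp
  have "emeasure ?M UNIV = emeasure ?M (hdisk R)"
    unfolding hpt_measure_def using borel_measurable_hpt_density Hm
    by (subst (1 2) emeasure_density) (auto intro!: nn_integral_cong simp: indicator_def)
  also have "\<dots> = ennreal ((cosh (\<alpha> * R) - 1) / (2 * pi * (cosh (\<alpha> * R) - 1))) * ennreal (2 * pi)"
    unfolding H using assms by (subst emeasure_hpt_sector) auto
  also have "\<dots> = ennreal ((cosh (\<alpha> * R) - 1) / (2 * pi * (cosh (\<alpha> * R) - 1)) * (2 * pi))"
    using cosh_real_ge_1 by (intro ennreal_mult[symmetric] divide_nonneg_nonneg mult_nonneg_nonneg) auto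
  also have "\<dots> = 1" using c by simp
  finally show "emeasure ?M (space ?M) = 1" by simp
qed

text \<open>Since \<open>cosh x - 1 = exp x * (1 - exp (- x))\<^sup>2 / 2\<close>, the ratio is
  \<open>exp (b - a)\<close> times a ratio of squares that is at most 1.\<close>

lemma cosh_minus_one_ratio_le:
  fixes a b :: real
  assumes "0 \<le> b" "b \<le> a" "0 < a"
  shows "(cosh b - 1) / (cosh a - 1) \<le> exp (b - a)"
proof -
  have f: "cosh x - 1 = exp x * (1 - exp (- x))\<^sup>2 / 2" for x :: real
    by (simp add: cosh_def power2_eq_square algebra_simps exp_minus_inverse flip: exp_add)
  have "cosh a - 1 > 0" using assms cosh_real_ge_1[of a] by (simp add: less_le)
  moreover have "cosh b - 1 \<le> exp (b - a) * (cosh a - 1)"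
  proof -
    have "(1 - exp (- b))\<^sup>2 \<le> (1 - exp (- a))\<^sup>2" using assms by (intro power_mono) auto
    then have "exp b * (1 - exp (- b))\<^sup>2 / 2 \<le> exp b * (1 - exp (- a))\<^sup>2 / 2" by simp
    also have "\<dots> = exp (b - a) * (exp a * (1 - exp (- a))\<^sup>2 / 2)" by (simp add: exp_diff)
    finally show ?thesis unfolding f .
  qed
  ultimately show ?thesis by (simp add: divide_le_eq)
qed

text \<open>The space of the measure is the whole plane, so the complement also contains the points
  outside the disk; they carry no mass. What remains is an exact ratio of \<open>cosh - 1\<close>
  terms.\<close>

lemma measure_hpt_inner_disk_le:
  assumes \<alpha>: "0 < \<alpha>" and C: "0 \<le> C" "C < R"
  shows "measure (hpt_measure \<alpha> R) (UNIV - {R - C..<R} \<times> {0<..2 * pi}) \<le> exp (- \<alpha> * C)"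
proof -
  let ?M = "hpt_measure \<alpha> R" and ?G = "{R - C..<R} \<times> {0<..2 * pi}"
  interpret prob_space ?M using assms by (intro prob_space_hpt_measure) auto
  have G: "?G \<in> sets ?M" by (simp add: borel_Times)
  have c: "cosh (\<alpha> * R) - 1 > 0"
    using \<alpha> C cosh_real_ge_1[of "\<alpha> * R"] by (simp add: less_le)
  have m: "cosh (\<alpha> * (R - C)) \<le> cosh (\<alpha> * R)"
    using \<alpha> C by (subst cosh_real_nonneg_le_iff) auto
  have "emeasure ?M ?G = ennreal ((cosh (\<alpha> * R) - cosh (\<alpha> * (R - C))) / (2 * pi * (cosh (\<alpha> * R) - 1))) * ennreal (2 * pi)"
    using assms by (subst emeasure_hpt_sector) auto
  also have "\<dots> = ennreal ((cosh (\<alpha> * R) - cosh (\<alpha> * (R - C))) / (2 * pi * (cosh (\<alpha> * R) - 1)) * (2 * pi))"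
    using m c by (intro ennreal_mult[symmetric] divide_nonneg_nonneg mult_nonneg_nonneg) auto
  also have "(cosh (\<alpha> * R) - cosh (\<alpha> * (R - C))) / (2 * pi * (cosh (\<alpha> * R) - 1)) * (2 * pi)
      = 1 - (cosh (\<alpha> * (R - C)) - 1) / (cosh (\<alpha> * R) - 1)"
  proof -
    have "(u - v) / (2 * pi * (u - 1)) * (2 * pi) = 1 - (v - 1) / (u - 1)" if "u - 1 > 0" for u v :: real
    proof -
      have "(u - v) / (2 * pi * (u - 1)) * (2 * pi) = ((u - 1) - (v - 1)) / (u - 1)" by simp
      also have "\<dots> = 1 - (v - 1) / (u - 1)" by (subst diff_divide_distrib) (use that in simp)
      finally show ?thesis .
    qed
    then show ?thesis using c .
  qed
  finally have "measure ?M ?G = 1 - (cosh (\<alpha> * (R - C)) - 1) / (cosh (\<alpha> * R) - 1)"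
    using c m by (intro measure_eq_emeasure_eq_ennreal) auto
  then have "measure ?M (UNIV - ?G) = (cosh (\<alpha> * (R - C)) - 1) / (cosh (\<alpha> * R) - 1)"
    using prob_compl[OF G] by simp
  also have "\<dots> \<le> exp (\<alpha> * (R - C) - \<alpha> * R)"
    using \<alpha> C by (intro cosh_minus_one_ratio_le) auto
  finally show ?thesis by (simp add: algebra_simps)
qed

section \<open>Hyperbolic geometry: adjacent outer points have nearby angles\<close>

text \<open>Sine is concave on the interval, so its graph lies above the chord from 0 to
  \<open>pi / 2\<close>.\<close>

lemma Jordan_inequality:
  assumes "0 \<le> x" "x \<le> pi / 2"
  shows "2 / pi * x \<le> sin x"
proof -
  have cv: "convex_on {0..pi / 2} (\<lambda>x. - sin x)"
    by (rule f''_ge0_imp_convex[where f' = "\<lambda>x. - cos x" and f'' = "\<lambda>x. sin x"])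
      (auto intro!: derivative_eq_intros sin_ge_zero)
  define t where "t = 2 / pi * x"
  have t: "0 \<le> t" "t \<le> 1" "x = t * (pi / 2)" using assms by (auto simp: t_def field_simps)
  have "- sin ((1 - t) *\<^sub>R 0 + t *\<^sub>R (pi / 2)) \<le> (1 - t) * (- sin 0) + t * (- sin (pi / 2))"
    using t by (intro convex_onD[OF cv]) auto
  then have "t \<le> sin (t * (pi / 2))" by simp
  then show ?thesis unfolding t(3)[symmetric] by (simp only: t_def)
qed

text \<open>Half the angular difference lies strictly between \<open>- pi\<close> and
  \<open>pi\<close>, where a small sine means closeness to 0 or to one of the ends. The ends are the
  wrap-around at the cut, covered by the shifts \<open>j = -1\<close> and
  \<open>j = 1\<close>.\<close>

lemma angle_near_if_sin_half_small:
  assumes \<theta>: "0 < \<theta>1" "\<theta>1 \<le> 2 * pi" "0 < \<theta>2" "\<theta>2 \<le> 2 * pi"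
    and s: "\<bar>sin ((\<theta>1 - \<theta>2) / 2)\<bar> \<le> s"
  shows "\<exists>j\<in>{-1, 0, 1}. \<bar>\<theta>2 - (\<theta>1 + 2 * pi * j)\<bar> \<le> pi * s"
proof -
  define d where "d = \<bar>\<theta>1 - \<theta>2\<bar> / 2"
  have d: "0 \<le> d" "d < pi" using \<theta> by (auto simp: d_def)
  have "sin d \<le> s"
  proof (cases "\<theta>1 \<le> \<theta>2")
    case True
    then have "d = - ((\<theta>1 - \<theta>2) / 2)" by (simp add: d_def field_simps)
    then have "sin d = - sin ((\<theta>1 - \<theta>2) / 2)" by (simp only: sin_minus)
    then show ?thesis using s by linarith
  next
    case False
    then have "d = (\<theta>1 - \<theta>2) / 2" by (simp add: d_def field_simps)
    then have "sin d = sin ((\<theta>1 - \<theta>2) / 2)" by (rule arg_cong)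
    then show ?thesis using s by linarith
  qed
  consider "d \<le> pi / 2" | "pi / 2 \<le> d" by linarith
  \<comment> \<open>Jordan's inequality is applied to \<open>d\<close> or to its reflection
    \<open>pi - d\<close>, which has the same sine.\<close>
  then have "2 * d \<le> pi * s \<or> 2 * (pi - d) \<le> pi * s"
  proof cases
    case 1
    then have "2 / pi * d \<le> s" using Jordan_inequality[of d] d \<open>sin d \<le> s\<close> by linarith
    then show ?thesis by (simp add: field_simps)
  next
    case 2
    then have "2 / pi * (pi - d) \<le> s"
      using Jordan_inequality[of "pi - d"] d \<open>sin d \<le> s\<close> by simp
    then show ?thesis by (simp add: field_simps)
  qed
  then show ?thesis
  proof
    assume "2 * d \<le> pi * s"
    then have "\<bar>\<theta>2 - (\<theta>1 + 2 * pi * 0)\<bar> \<le> pi * s" by (auto simp: d_def)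
    then show ?thesis by blast
  next
    assume h: "2 * (pi - d) \<le> pi * s"
    show ?thesis
    proof (cases "\<theta>1 \<le> \<theta>2")
      case True
      then have "\<theta>1 + 2 * pi - \<theta>2 = 2 * (pi - d)" by (simp add: d_def field_simps)
      then have "\<theta>1 + 2 * pi - \<theta>2 \<le> pi * s" using h by simp
      then have "\<bar>\<theta>2 - (\<theta>1 + 2 * pi * 1)\<bar> \<le> pi * s" using \<theta> by linarith
      then show ?thesis by blast
    next
      case False
      then have "\<theta>2 + 2 * pi - \<theta>1 = 2 * (pi - d)" by (simp add: d_def field_simps)
      then have "\<theta>2 + 2 * pi - \<theta>1 \<le> pi * s" using h by simp
      then have "\<bar>\<theta>2 - (\<theta>1 + 2 * pi * (-1))\<bar> \<le> pi * s" using \<theta> by linarith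
      then show ?thesis by blast
    qed
  qed
qed

text \<open>The half-angle formula turns the law of cosines into
  \<open>cosh (r1 - r2) + 2 * sinh r1 * sinh r2 * s\<^sup>2\<close>, where \<open>s\<close> is the
  sine of half the angle. This is at most \<open>cosh R\<close>, and each \<open>sinh\<close> factor
  is at least \<open>exp (R - C) / 4\<close>, which forces \<open>s\<close> to be small.\<close>

lemma sin_half_angle_le_if_hdist_le:
  assumes C: "1 + C \<le> R" and r: "R - C \<le> r1" "R - C \<le> r2"
    and h: "hdist (r1, \<theta>1) (r2, \<theta>2) \<le> R"
  shows "\<bar>sin ((\<theta>1 - \<theta>2) / 2)\<bar> \<le> 3 * exp (C - R / 2)"
proof -
  define y where "y = cosh r1 * cosh r2 - sinh r1 * sinh r2 * cos (\<theta>1 - \<theta>2)"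
  define s where "s = sin ((\<theta>1 - \<theta>2) / 2)"
  have r1: "1 \<le> r1" "1 \<le> r2" using C r by auto
  have cs: "1 - cos (\<theta>1 - \<theta>2) = 2 * s\<^sup>2"
  proof -
    have "\<theta>1 - \<theta>2 = 2 * ((\<theta>1 - \<theta>2) / 2)" by (simp add: field_simps)
    then have "cos (\<theta>1 - \<theta>2) = cos (2 * ((\<theta>1 - \<theta>2) / 2))" by (rule arg_cong)
    also have "\<dots> = 1 - 2 * s\<^sup>2" unfolding s_def by (rule cos_double_sin)
    finally show ?thesis by simp
  qed
  have yc: "y = cosh (r1 - r2) + sinh r1 * sinh r2 * (2 * s\<^sup>2)"
    unfolding y_def cosh_diff cs[symmetric] by (simp add: algebra_simps)
  have "0 \<le> sinh r1 * sinh r2 * (2 * s\<^sup>2)" using r1 by (intro mult_nonneg_nonneg) auto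
  \<comment> \<open>The identity \<open>cosh (arcosh y) = y\<close> is used below, and it is valid
    from 1 on.\<close>
  then have y1: "1 \<le> y" using cosh_real_ge_1[of "r1 - r2"] yc by linarith
  have "arcosh y \<le> R" using h by (simp add: hdist_def y_def)
  then have "cosh (arcosh y) \<le> cosh R"
    using y1 by (subst cosh_real_nonneg_le_iff) (auto intro: order_trans[OF arcosh_nonneg_real])
  then have "y \<le> cosh R" using y1 by simp
  also have "cosh R \<le> exp R"
  proof -
    have "0 \<le> arcosh y" using y1 by simp
    then have "0 \<le> R" using \<open>arcosh y \<le> R\<close> by linarith
    then have "exp (- R) \<le> exp R" by simp
    then show ?thesis by (simp add: cosh_def)
  qed
  finally have up: "sinh r1 * sinh r2 * (2 * s\<^sup>2) \<le> exp R"
    using yc cosh_real_nonneg[of "r1 - r2"] by linarith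
  \<comment> \<open>The hypothesis \<open>1 + C \<le> R\<close> keeps both radii at least 1, where
    \<open>exp (- r)\<close> is at most half of \<open>exp r\<close>.\<close>
  have sh: "exp (R - C) / 4 \<le> sinh r" if "1 \<le> r" "R - C \<le> r" for r
  proof -
    have "3 \<le> exp (2 * r)" using exp_ge_add_one_self[of "2 * r"] that by linarith
    then have "2 * exp (- r) \<le> exp (2 * r) * exp (- r)" by (intro mult_right_mono) auto
    also have "\<dots> = exp r" by (simp flip: exp_add)
    finally have "exp r / 4 \<le> sinh r" by (simp add: sinh_def)
    moreover have "exp (R - C) \<le> exp r" using that by simp
    ultimately show ?thesis by linarith
  qed
  have "(exp (R - C) / 4) * (exp (R - C) / 4) * (2 * s\<^sup>2) \<le> sinh r1 * sinh r2 * (2 * s\<^sup>2)"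
    using sh[OF r1(1) r(1)] sh[OF r1(2) r(2)] r1 by (intro mult_right_mono mult_mono) auto
  from order_trans[OF this up] have "(exp (R - C))\<^sup>2 * s\<^sup>2 \<le> 8 * exp R"
    by (simp add: power2_eq_square field_simps)
  then have "(exp (R - C))\<^sup>2 * s\<^sup>2 * exp (2 * C - 2 * R) \<le> 8 * exp R * exp (2 * C - 2 * R)"
    by (intro mult_right_mono) auto
  moreover have "(exp (R - C))\<^sup>2 * s\<^sup>2 * exp (2 * C - 2 * R) = s\<^sup>2"
  proof -
    have "(exp (R - C))\<^sup>2 * exp (2 * C - 2 * R) = 1"
      by (simp flip: exp_double exp_add)
    then show ?thesis by (simp add: mult_ac)
  qed
  \<comment> \<open>Here 8 is rounded up to the square 9.\<close>
  moreover have "8 * exp R * exp (2 * C - 2 * R) \<le> (3 * exp (C - R / 2))\<^sup>2"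
  proof -
    have "exp R * exp (2 * C - 2 * R) = (exp (C - R / 2))\<^sup>2"
      by (simp flip: exp_double exp_add)
    then show ?thesis unfolding mult.assoc power_mult_distrib by simp
  qed
  ultimately have "s\<^sup>2 \<le> (3 * exp (C - R / 2))\<^sup>2" by linarith
  then have "\<bar>s\<bar>\<^sup>2 \<le> (3 * exp (C - R / 2))\<^sup>2" by (simp only: power2_abs)
  then have "\<bar>s\<bar> \<le> 3 * exp (C - R / 2)" by (rule power2_le_imp_le) simp
  then show ?thesis by (simp add: s_def)
qed

text \<open>A neighbour has its angle in one of three windows of length \<open>2 * pi * s\<close>,
  where \<open>s = 3 * exp (C - R / 2)\<close>. The angular density is at most
  \<open>1 / (2 * pi)\<close>, so the mass is at most \<open>3 * s\<close>.\<close>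

lemma measure_hpt_neighbourhood_le:
  assumes \<alpha>: "0 < \<alpha>" and C: "0 \<le> C" "1 + C \<le> R"
    and x: "x \<in> {R - C..<R} \<times> {0<..2 * pi}"
  shows "measure (hpt_measure \<alpha> R) {y. y \<in> {R - C..<R} \<times> {0<..2 * pi} \<and> hdist x y \<le> R}
    \<le> 9 * exp (C - R / 2)"
proof -
  let ?M = "hpt_measure \<alpha> R"
  interpret prob_space ?M using assms by (intro prob_space_hpt_measure) auto
  obtain r1 \<theta>1 where x1: "x = (r1, \<theta>1)" by (cases x)
  define s where "s = 3 * exp (C - R / 2)"
  have s0: "0 \<le> s" by (simp add: s_def)
  define I where "I j = {\<theta>1 + 2 * pi * j - pi * s .. \<theta>1 + 2 * pi * j + pi * s}" for j :: real
  define J where "J = {0<..2 * pi} \<inter> (\<Union>j\<in>{-1, 0, 1}. I j)"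
  have Jm: "J \<in> sets borel" unfolding J_def I_def by (intro sets.Int sets.finite_UN) auto
  have JI: "emeasure lborel J \<le> ennreal (6 * pi * s)"
  proof -
    have "emeasure lborel J \<le> emeasure lborel (\<Union>j\<in>{-1, 0, 1}. I j)"
      unfolding J_def I_def by (intro emeasure_mono) auto
    also have "\<dots> \<le> (\<Sum>j\<in>{-1, 0, 1}. emeasure lborel (I j))"
      unfolding I_def by (intro emeasure_subadditive_finite) auto
    also have "\<dots> = (\<Sum>j\<in>{-1, 0, 1 :: real}. ennreal (2 * pi * s))"
      using s0 unfolding I_def by (intro sum.cong refl) simp
    also have "\<dots> = ennreal (6 * pi * s)"
      using s0 by (subst sum_ennreal) auto
    finally show ?thesis .
  qed
  have c: "cosh (\<alpha> * R) - 1 > 0"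
    using \<alpha> C cosh_real_ge_1[of "\<alpha> * R"] by (auto simp: less_le)
  have sub: "{y. y \<in> {R - C..<R} \<times> {0<..2 * pi} \<and> hdist x y \<le> R} \<subseteq> {R - C..<R} \<times> J"
  proof
    fix y assume y: "y \<in> {y. y \<in> {R - C..<R} \<times> {0<..2 * pi} \<and> hdist x y \<le> R}"
    obtain r2 \<theta>2 where y1: "y = (r2, \<theta>2)" by (cases y)
    have "\<bar>sin ((\<theta>1 - \<theta>2) / 2)\<bar> \<le> s"
      unfolding s_def using x y C unfolding x1 y1
      by (intro sin_half_angle_le_if_hdist_le[of C R r1 r2]) auto
    then have "\<exists>j\<in>{-1, 0, 1}. \<bar>\<theta>2 - (\<theta>1 + 2 * pi * j)\<bar> \<le> pi * s"
      using x y unfolding x1 y1 by (intro angle_near_if_sin_half_small) auto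
    then obtain j where j: "j \<in> {-1, 0, 1}" "\<bar>\<theta>2 - (\<theta>1 + 2 * pi * j)\<bar> \<le> pi * s" by (rule bexE)
    from j(2) have "\<theta>2 \<in> I j" unfolding I_def by (auto simp: abs_le_iff)
    with j(1) have "\<theta>2 \<in> J" using y unfolding y1 J_def by blast
    then show "y \<in> {R - C..<R} \<times> J" using y unfolding y1 by simp
  qed
  have "emeasure ?M ({R - C..<R} \<times> J) =
    ennreal ((cosh (\<alpha> * R) - cosh (\<alpha> * (R - C))) / (2 * pi * (cosh (\<alpha> * R) - 1))) * emeasure lborel J"
    using assms Jm by (intro emeasure_hpt_sector) (auto simp: J_def)
  also have "\<dots> \<le> ennreal (1 / (2 * pi)) * ennreal (6 * pi * s)"
  proof (intro mult_mono JI ennreal_leI)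
    have "(cosh (\<alpha> * R) - cosh (\<alpha> * (R - C))) / (2 * pi * (cosh (\<alpha> * R) - 1))
        \<le> (cosh (\<alpha> * R) - 1) / (2 * pi * (cosh (\<alpha> * R) - 1))"
      using c cosh_real_ge_1[of "\<alpha> * (R - C)"] by (intro divide_right_mono) auto
    also have "\<dots> = 1 / (2 * pi)" using c \<alpha> C by auto
    finally show "(cosh (\<alpha> * R) - cosh (\<alpha> * (R - C))) / (2 * pi * (cosh (\<alpha> * R) - 1)) \<le> 1 / (2 * pi)" .
  qed auto
  also have "\<dots> = ennreal (3 * s)" using s0 by (subst ennreal_mult[symmetric]) auto
  finally have "measure ?M ({R - C..<R} \<times> J) \<le> 3 * s"
    using s0 by (simp add: emeasure_eq_measure)
  moreover have "measure ?M {y. y \<in> {R - C..<R} \<times> {0<..2 * pi} \<and> hdist x y \<le> R} \<le> measure ?M ({R - C..<R} \<times> J)"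
    using sub Jm by (intro finite_measure_mono) (auto intro: borel_Times)
  ultimately show ?thesis by (simp add: s_def)
qed

section \<open>The general bound applied to the hyperbolic graph\<close>

lemma hdist_commute: "hdist p q = hdist q p"
proof -
  have "cos (a - b) = cos (b - a)" for a b :: real by (metis cos_minus minus_diff_eq)
  then show ?thesis by (simp add: hdist_def split_beta mult.commute)
qed

lemma pred_hdist_le:
  "Measurable.pred (hpt_measure \<alpha> R \<Otimes>\<^sub>M hpt_measure \<alpha> R) (\<lambda>(p, q). hdist p q \<le> R)"
proof -
  let ?y = "\<lambda>z :: (real \<times> real) \<times> (real \<times> real). cosh (fst (fst z)) * cosh (fst (snd z))
    - sinh (fst (fst z)) * sinh (fst (snd z)) * cos (snd (fst z) - snd (snd z))"
  have prod_sets: "sets (hpt_measure \<alpha> R \<Otimes>\<^sub>M hpt_measure \<alpha> R) = sets borel"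
    by (subst borel_prod[symmetric], intro sets_pair_measure_cong) simp_all
  have y: "?y \<in> borel_measurable borel"
    by (intro borel_measurable_continuous_onI continuous_intros)
  have "(\<lambda>z. arcosh (?y z)) \<in> borel_measurable borel"
    unfolding arcosh_def using y by measurable
  then have "Measurable.pred borel (\<lambda>z. arcosh (?y z) \<le> R)" by measurable
  then have "Measurable.pred (hpt_measure \<alpha> R \<Otimes>\<^sub>M hpt_measure \<alpha> R) (\<lambda>z. arcosh (?y z) \<le> R)"
    unfolding measurable_cong_sets[OF prod_sets refl] .
  then show ?thesis by (simp add: hdist_def split_beta')
qed

text \<open>A set outside the sigma-algebra has \<open>measure\<close> 0 by convention, so this
  certifies that the terms of \<open>prob_npm\<close> are genuine probabilities.\<close>

lemma npm_event_sets: "npm_event \<alpha> R k \<in> sets (PiM {..<k} (\<lambda>_. hpt_measure \<alpha> R))"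
  unfolding npm_event_def hgraph_adj_def by (rule near_perfect_matching_sets[OF pred_hdist_le])

text \<open>The general bound with the outer annulus as \<open>G\<close>: the inner mass and
  \<open>k\<close> neighbourhoods together must fit into \<open>1 / 6\<close>.\<close>

lemma measure_npm_event_le:
  assumes \<alpha>: "0 < \<alpha>" and C: "0 \<le> C" "1 + C \<le> R"
    and k: "exp (- \<alpha> * C) + real k * (9 * exp (C - R / 2)) \<le> 1 / 6"
  shows "measure (PiM {..<k} (\<lambda>_. hpt_measure \<alpha> R)) (npm_event \<alpha> R k) \<le> 2 * (3/4) ^ k"
  unfolding npm_event_def hgraph_adj_def
proof (rule prob_near_perfect_matching_le[OF _ _ pred_hdist_le _ _ _ _ k])
  show "prob_space (hpt_measure \<alpha> R)" using assms by (intro prob_space_hpt_measure) auto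
  show "{R - C..<R} \<times> {0<..2 * pi} \<in> sets (hpt_measure \<alpha> R)" by (simp add: borel_Times)
  show "measure (hpt_measure \<alpha> R) (space (hpt_measure \<alpha> R) - {R - C..<R} \<times> {0<..2 * pi}) \<le> exp (- \<alpha> * C)"
    using measure_hpt_inner_disk_le[of \<alpha> C R] assms by simp
  show "measure (hpt_measure \<alpha> R) {y \<in> space (hpt_measure \<alpha> R).
      y \<in> {R - C..<R} \<times> {0<..2 * pi} \<and> hdist x y \<le> R} \<le> 9 * exp (C - R / 2)"
    if "x \<in> {R - C..<R} \<times> {0<..2 * pi}" for x
    using measure_hpt_neighbourhood_le[OF \<alpha> C that] by simp
  show "(hdist p q \<le> R) = (hdist q p \<le> R)" for p q by (simp add: hdist_commute)
qed simp

section \<open>Poisson averaging and the choice of constants\<close>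

lemma exp_series_sums: "(\<lambda>k. x ^ k / fact k) sums exp (x :: real)"
  using exp_converges[of x] by (simp add: divide_inverse mult.commute)

text \<open>The tail \<open>k > 2 * n\<close>, where nothing is known about \<open>p\<close>, is absorbed by the weight
  \<open>2 ^ k / 4 ^ n\<close>, which is at least 1 there.\<close>
lemma poisson_mixture_le:
  fixes p :: "nat \<Rightarrow> real"
  assumes p0: "\<And>k. 0 \<le> p k" and p1: "\<And>k. p k \<le> 1"
    and p: "\<And>k. k \<le> 2 * n \<Longrightarrow> p k \<le> 2 * (3/4) ^ k"
  shows "0 \<le> (\<Sum>k. exp (- real n) * real n ^ k / fact k * p k)" (is "0 \<le> suminf ?f")
    and "(\<Sum>k. exp (- real n) * real n ^ k / fact k * p k) \<le> 3 * exp (- real n / 4)"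
proof -
  let ?N = "real n"
  \<comment> \<open>The Poisson weights times \<open>2 * (3/4) ^ k\<close> and times
    \<open>2 ^ k / 4 ^ n\<close>; both give exponential series, with sums
    \<open>2 * exp (- n / 4)\<close> and \<open>exp n / 4 ^ n\<close>.\<close>
  let ?g = "\<lambda>k. exp (- ?N) * 2 * ((3/4 * ?N) ^ k / fact k) + exp (- ?N) / 4 ^ n * ((2 * ?N) ^ k / fact k)"
  have g: "?g sums (exp (- ?N) * 2 * exp (3/4 * ?N) + exp (- ?N) / 4 ^ n * exp (2 * ?N))"
    by (intro sums_add sums_mult exp_series_sums)
  have fg: "?f k \<le> ?g k" for k
  proof -
    have "p k \<le> 2 * (3/4) ^ k + 2 ^ k / 4 ^ n"
    proof (cases "k \<le> 2 * n")
      case True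
      then have "p k \<le> 2 * (3/4) ^ k" by (rule p)
      moreover have "(0::real) \<le> 2 ^ k / 4 ^ n" by simp
      ultimately show ?thesis by linarith
    next
      case False
      then have "(2::real) ^ (2 * n) \<le> 2 ^ k" by (intro power_increasing) auto
      then have "(1::real) \<le> 2 ^ k / 4 ^ n" by (simp add: power_mult)
      moreover have "(0::real) \<le> 2 * (3/4) ^ k" by simp
      ultimately show ?thesis using p1[of k] by linarith
    qed
    then have "?f k \<le> exp (- ?N) * ?N ^ k / fact k * (2 * (3/4) ^ k + 2 ^ k / 4 ^ n)"
      by (intro mult_left_mono) auto
    also have "\<dots> = ?g k" unfolding power_mult_distrib by (simp add: distrib_left mult_ac)
    finally show ?thesis .
  qed
  have f0: "0 \<le> ?f k" for k using p0 by simp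
  have fs: "summable ?f"
  proof (rule summable_comparison_test'[OF sums_summable[OF g], of 0])
    show "norm (?f k) \<le> ?g k" for k
      using fg[of k] f0[of k] by (simp only: real_norm_def abs_of_nonneg)
  qed
  show "0 \<le> suminf ?f" by (rule suminf_nonneg[OF fs f0])
  have "suminf ?f \<le> suminf ?g" by (rule suminf_le[OF fg fs sums_summable[OF g]])
  also have "\<dots> = exp (- ?N) * 2 * exp (3/4 * ?N) + exp (- ?N) / 4 ^ n * exp (2 * ?N)"
    using g by (rule sums_unique[symmetric])
  also have "\<dots> \<le> 3 * exp (- ?N / 4)"
  proof -
    \<comment> \<open>The tail term decays because \<open>exp 1 \<le> 3 < 4\<close>, and
      \<open>3/4 \<le> exp (- 1 / 4)\<close> brings it to the rate of the main term.\<close>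
    have "exp ?N = exp 1 ^ n" by (simp flip: exp_of_nat_mult)
    also have "\<dots> \<le> 3 ^ n" by (intro power_mono exp_le) simp
    finally have "exp ?N / 4 ^ n \<le> (3/4) ^ n" by (simp add: power_divide divide_right_mono)
    also have "\<dots> \<le> exp (- 1 / 4) ^ n"
      using exp_ge_add_one_self[of "- 1 / 4"] by (intro power_mono) auto
    also have "\<dots> = exp (- ?N / 4)" by (simp flip: exp_of_nat_mult)
    finally have "exp ?N / 4 ^ n \<le> exp (- ?N / 4)" .
    moreover
    have "exp (- ?N) * exp (3/4 * ?N) = exp (- ?N / 4)" "exp (- ?N) * exp (2 * ?N) = exp ?N"
      by (simp_all flip: exp_add)
    ultimately show ?thesis by (simp add: mult_ac)
  qed
  finally show "suminf ?f \<le> 3 * exp (- ?N / 4)" .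
qed

theorem mainTheorem3:
  fixes \<alpha> :: real
  assumes "0 < \<alpha>" and "\<alpha> < 1/2"
  shows "\<exists>\<nu>0>0. \<forall>\<nu>. 0 < \<nu> \<and> \<nu> < \<nu>0 \<longrightarrow>
           (\<forall>n k. real n > \<nu> \<longrightarrow>
              npm_event \<alpha> (kpkvb_R \<nu> n) k
                \<in> sets (PiM {..<k} (\<lambda>_. hpt_measure \<alpha> (kpkvb_R \<nu> n)))) \<and>
           (\<lambda>n. prob_npm \<alpha> \<nu> n) \<in> o[at_top](\<lambda>n. real n powr (-1/2))"
proof -
  \<comment> \<open>The inner mass then takes at most \<open>1 / 12\<close>, half of the permitted
    \<open>1 / 6\<close>.\<close>
  define C where "C = ln 12 / \<alpha>"
  have C: "0 \<le> C" "exp (- \<alpha> * C) = 1 / 12" using assms by (simp_all add: C_def exp_minus)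
  \<comment> \<open>For \<open>k \<le> 2 * n\<close> the \<open>k\<close> neighbourhoods contribute
    at most \<open>18 * exp C * \<nu>\<close>; below this \<open>\<nu>0\<close> that is at most
    \<open>1 / 12\<close>, the other half.\<close>
  define \<nu>0 where "\<nu>0 = 1 / (216 * exp C)"
  have "(\<lambda>n. prob_npm \<alpha> \<nu> n) \<in> o[at_top](\<lambda>n. real n powr (-1/2))" if \<nu>: "0 < \<nu>" "\<nu> < \<nu>0" for \<nu>
  proof -
    have "filterlim (kpkvb_R \<nu>) at_top at_top"
      unfolding kpkvb_R_def using \<nu> by real_asymp
    then have "eventually (\<lambda>n. 1 + C \<le> kpkvb_R \<nu> n) at_top" by (simp add: filterlim_at_top)
    moreover have "eventually (\<lambda>n::nat. n > 0) at_top" by (rule eventually_gt_at_top)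
    ultimately have "eventually (\<lambda>n. norm (prob_npm \<alpha> \<nu> n)
        \<le> 1 * norm (3 * exp (- real n / 4))) at_top"
    proof eventually_elim
      case (elim n)
      define R where "R = kpkvb_R \<nu> n"
      let ?p = "\<lambda>k. measure (PiM {..<k} (\<lambda>_. hpt_measure \<alpha> R)) (npm_event \<alpha> R k)"
      have R: "1 + C \<le> R" "0 < R" using elim C by (auto simp: R_def)
      have M: "prob_space (hpt_measure \<alpha> R)" using R assms by (intro prob_space_hpt_measure)
      \<comment> \<open>Since \<open>R = 2 * ln (n / \<nu>)\<close>, the factor
        \<open>exp (- R / 2)\<close> is \<open>\<nu> / n\<close>; its denominator cancels against
        the number of points.\<close>
      have eR: "exp (C - R / 2) = exp C * (\<nu> / real n)"
        using elim \<nu> by (simp add: R_def kpkvb_R_def exp_diff)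
      have p: "?p k \<le> 2 * (3/4) ^ k" if k: "k \<le> 2 * n" for k
      proof (rule measure_npm_event_le[OF assms(1) C(1) R(1)])
        have "real k * (9 * exp (C - R / 2)) \<le> real (2 * n) * (9 * exp (C - R / 2))"
          using k by (intro mult_right_mono) (auto simp only: of_nat_le_iff, simp)
        also have "\<dots> = 18 * exp C * \<nu>" using elim by (simp add: eR)
        also have "\<dots> \<le> 18 * exp C * \<nu>0" using \<nu> by simp
        also have "\<dots> = 1 / 12" by (simp add: \<nu>0_def)
        finally show "exp (- \<alpha> * C) + real k * (9 * exp (C - R / 2)) \<le> 1 / 6" using C(2) by linarith
      qed
      have p1: "?p k \<le> 1" for k
        using prob_space.prob_le_1[OF prob_space_PiM[of "{..<k}" "\<lambda>_. hpt_measure \<alpha> R"]] M by simp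
      have "prob_npm \<alpha> \<nu> n = (\<Sum>k. exp (- real n) * real n ^ k / fact k * ?p k)"
        by (simp add: prob_npm_def R_def Let_def)
      then show ?case
        using poisson_mixture_le[of ?p n, OF measure_nonneg p1 p] by simp
    qed
    then have "prob_npm \<alpha> \<nu> \<in> O(\<lambda>n. 3 * exp (- real n / 4))"
      by (rule bigoI)
    also have "(\<lambda>n. 3 * exp (- real n / 4)) \<in> o(\<lambda>n. real n powr (-1/2))"
      by real_asymp
    finally show ?thesis by simp
  qed
  moreover have "0 < \<nu>0" by (simp add: \<nu>0_def)
  ultimately show ?thesis using npm_event_sets by blast
qed

end
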